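(* Let $A$, $B$, $C$, $D$ be four distinct, collinear, pairwise non-antipodal points on $\mathbb{S}^2$ or $\mathbb{H}^2$, modeled on the unit sphere or the hyperboloid respectively. Let $w$ be a plane in $\mathbb{R}^3$ not passing through the origin such that the images $A'$, $B'$, $C'$, $D'$ of the four points under central projection from the origin to $w$ all exist. Then the cross-ratio of $A,B,C,D$ in $\mathbb{S}^2$ (resp. $\mathbb{H}^2$) equals the Euclidean cross-ratio of the images in $w$: $$(ABCD)_{\mathbb{S}^2\,(\mathbb{H}^2)}=(A'B'C'D')_{\mathbb{E}^2}.$$
   Context: $\mathbb{S}^2$ is the unit sphere $x^2+y^2+z^2=1$ in $\mathbb{R}^3$ with the induced metric. $\mathbb{H}^2$ is the upper sheet $x^2+y^2-z^2=-1$, $z>0$, with the metric induced by $ds^2=dx^2+dy^2-dz^2$. Lines (geodesics) in $\mathbb{S}^2$, $\mathbb{H}^2$ are intersections of the surface with planes through the origin; points are collinear if they lie on a common line. Two points of $\mathbb{S}^2$ are antipodal if they are the two intersection points of $\mathbb{S}^2$ with a line through the origin (the condition is vacuous in $\mathbb{H}^2$). Let $\operatorname{gsin}(x)=\sin x$ in $\mathbb{S}^2$, $x$ in $\mathbb{E}^2$, and $\sinh x$ in $\mathbb{H}^2$. For four distinct pairwise non-antipodal points on an oriented line, the cross-ratio is $$(ABCD)=\frac{\operatorname{gsin}(AC)}{\operatorname{gsin}(AD)}\cdot\frac{\operatorname{gsin}(BD)}{\operatorname{gsin}(BC)},$$ where $\operatorname{gsin}(XY)$ is the generalized sine of the signed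 distance from $X$ to $Y$ along the oriented line (in $\mathbb{S}^2$ both ways of travelling from $X$ to $Y$ give the same value; the cross-ratio does not depend on the orientation of the line). The subscript indicates the geometry in which it is computed; in $w$ the usual Euclidean distance of $\mathbb{R}^3$ is used. Central projection to $w$ sends a point $P$ to the intersection with $w$ of the line through the origin and $P$, if this intersection exists. *)

theory Defs
  imports "HOL-Analysis.Analysis"
begin

text \<open>
  The three geometries, each realised on a surface in \<open>\<real>\<^sup>3\<close>. The parameter of \<open>E2\<close> is the plane
  (not necessarily through the origin) that carries the Euclidean geometry.
\<close>

datatype geometry = S2 | H2 | E2 "(real^3) set"

definition minkowski :: "real^3 \<Rightarrow> real^3 \<Rightarrow> real" where
  "minkowski x y = x$1 * y$1 + x$2 * y$2 - x$3 * y$3"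

fun surface :: "geometry \<Rightarrow> (real^3) set" where
  "surface S2 = {x. (x$1)\<^sup>2 + (x$2)\<^sup>2 + (x$3)\<^sup>2 = 1}"
| "surface H2 = {x. (x$1)\<^sup>2 + (x$2)\<^sup>2 - (x$3)\<^sup>2 = -1 \<and> x$3 > 0}"
| "surface (E2 w) = w"

text \<open>The ambient bilinear form whose restriction to tangent vectors is the metric of the surface.\<close>

fun metric_form :: "geometry \<Rightarrow> real^3 \<Rightarrow> real^3 \<Rightarrow> real" where
  "metric_form S2 = (\<bullet>)"
| "metric_form H2 = minkowski"
| "metric_form (E2 w) = (\<bullet>)"

fun gsin :: "geometry \<Rightarrow> real \<Rightarrow> real" where
  "gsin S2 x = sin x"
| "gsin H2 x = sinh x"
| "gsin (E2 w) x = x"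

text \<open>Planes through the origin that miss the upper sheet do not give lines of \<open>H2\<close>.\<close>

fun geo_lines :: "geometry \<Rightarrow> (real^3) set set" where
  "geo_lines S2 = {surface S2 \<inter> P | P. subspace P \<and> dim P = 2}"
| "geo_lines H2 = {surface H2 \<inter> P | P. subspace P \<and> dim P = 2 \<and> surface H2 \<inter> P \<noteq> {}}"
| "geo_lines (E2 w) = {L. affine L \<and> aff_dim L = 1 \<and> L \<subseteq> w}"

definition geo_collinear :: "geometry \<Rightarrow> (real^3) set \<Rightarrow> bool" where
  "geo_collinear G X \<longleftrightarrow> (\<exists>L \<in> geo_lines G. X \<subseteq> L)"

text \<open>In \<open>H2\<close> no two points are antipodal: a line through the origin meets the sheet at most once.\<close>

definition antipodal :: "geometry \<Rightarrow> real^3 \<Rightarrow> real^3 \<Rightarrow> bool" where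
  "antipodal G P Q \<longleftrightarrow>
     P \<noteq> Q \<and> (\<exists>l. subspace l \<and> dim l = 1 \<and> surface G \<inter> l = {P, Q})"

text \<open>
  An oriented line is given by a unit-speed parametrisation \<open>\<gamma>\<close> of the whole line. The signed
  distance from \<open>\<gamma> s\<close> to \<open>\<gamma> t\<close> along it is \<open>t - s\<close>; on the sphere \<open>\<gamma>\<close> has period \<open>2 * pi\<close>, and the
  choice of parameters of the two points amounts to the choice of the way of travelling.
\<close>

definition oriented_line :: "geometry \<Rightarrow> (real \<Rightarrow> real^3) \<Rightarrow> bool" where
  "oriented_line G \<gamma> \<longleftrightarrow>
     range \<gamma> \<in> geo_lines G \<and>
     (\<exists>\<gamma>'. continuous_on UNIV \<gamma>' \<and>
        (\<forall>t. (\<gamma> has_vector_derivative \<gamma>' t) (at t) \<and> metric_form G (\<gamma>' t) (\<gamma>' t) = 1))"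

text \<open>
  For four distinct collinear pairwise non-antipodal points, the value below depends neither on
  the oriented line \<open>\<gamma>\<close> nor on the parameters \<open>a b c d\<close> of the points on it.
\<close>

definition cross_ratio :: "geometry \<Rightarrow> real^3 \<Rightarrow> real^3 \<Rightarrow> real^3 \<Rightarrow> real^3 \<Rightarrow> real" where
  "cross_ratio G A B C D =
     (THE r. \<exists>\<gamma> a b c d. oriented_line G \<gamma> \<and> \<gamma> a = A \<and> \<gamma> b = B \<and> \<gamma> c = C \<and> \<gamma> d = D \<and>
        r = gsin G (c - a) / gsin G (d - a) * (gsin G (d - b) / gsin G (c - b)))"

definition has_central_proj :: "(real^3) set \<Rightarrow> real^3 \<Rightarrow> bool" where
  "has_central_proj w P \<longleftrightarrow> w \<inter> span {P} \<noteq> {}"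

definition central_proj :: "(real^3) set \<Rightarrow> real^3 \<Rightarrow> real^3" where
  "central_proj w P = (THE Q. Q \<in> w \<inter> span {P})"

end

theory Submission
  imports Defs
begin

text \<open>
  Write \<open>x \<times> y\<close> for the vector product. The idea is that on a line of any of the three geometries
  the generalized sine of a signed distance is an area: for every oriented line \<open>\<gamma>\<close> there is a
  fixed vector \<open>K\<close> with
  \<open>\<gamma>(s) \<times> \<gamma>(t) = gsin(t - s) K\<close>.
  This is \<open>oriented_line_cross3\<close>. For the explicit curves \<open>cos t u + sin t v\<close> on the sphere and
  \<open>cosh t u + sinh t v\<close> on the hyperboloid it is the addition theorem, and for \<open>p + t v\<close> in a
  Euclidean plane it is bilinearity. An oriented line, however, is given only by a differentiable unit-speed
  parametrisation. On the curved surfaces the proof therefore shows directly that the area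
  \<open>\<gamma>(s) \<times> \<gamma>(t)\<close> satisfies, as a function of \<open>t\<close>, the equation
  \<open>f'' = - \<kappa> f\<close> of the generalized sine, where \<open>\<kappa> = \<plusminus>1\<close> is the curvature.

  Consequently \<open>K\<close> cancels in the cross-ratio of four points, which becomes
  \<open>(N \<bullet> (A \<times> C)) / (N \<bullet> (A \<times> D)) * ((N \<bullet> (B \<times> D)) / (N \<bullet> (B \<times> C)))\<close>
  for any vector \<open>N\<close> not orthogonal to \<open>K\<close>
  (\<open>cross_ratio_eq_area_cross_ratio\<close>). In particular the value does not depend on the
  oriented line or on the parameters, so that the definite description in the definition of the
  cross-ratio is meaningful as soon as some oriented line carries the points. Such lines are
  exhibited in \<open>oriented_line_exists\<close> and \<open>euclidean_oriented_line_exists\<close>.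

  Central projection multiplies each of the four vectors by a nonzero scalar. Each vector occurs
  once in the numerator and once in the denominator of the area expression, so the scalars cancel,
  and with \<open>N = A \<times> B\<close> the same expression gives the cross-ratio on the surface and in the plane.
\<close>

section \<open>Generalized trigonometric functions\<close>

fun curvature :: "geometry \<Rightarrow> real" where
  "curvature S2 = 1"
| "curvature H2 = -1"
| "curvature (E2 w) = 0"

fun gcos :: "geometry \<Rightarrow> real \<Rightarrow> real" where
  "gcos S2 x = cos x"
| "gcos H2 x = cosh x"
| "gcos (E2 w) x = 1"

lemma gsin_deriv: "(gsin G has_real_derivative gcos G x) (at x)"
proof (cases G)
  case S2
  moreover have "gsin S2 = sin" by (rule ext) simp
  ultimately show ?thesis by (auto intro!: derivative_eq_intros)
next
  case H2
  moreover have "gsin H2 = sinh" by (rule ext) simp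
  ultimately show ?thesis by (auto intro!: derivative_eq_intros)
next
  case (E2 w)
  moreover have "gsin (E2 w) = (\<lambda>x. x)" by (rule ext) simp
  ultimately show ?thesis by (auto intro!: derivative_eq_intros)
qed

lemma gcos_deriv: "(gcos G has_real_derivative - curvature G * gsin G x) (at x)"
proof (cases G)
  case S2
  moreover have "gcos S2 = cos" by (rule ext) simp
  ultimately show ?thesis by (auto intro!: derivative_eq_intros)
next
  case H2
  moreover have "gcos H2 = cosh" by (rule ext) simp
  ultimately show ?thesis by (auto intro!: derivative_eq_intros)
next
  case (E2 w)
  moreover have "gcos (E2 w) = (\<lambda>x. 1)" by (rule ext) simp
  ultimately show ?thesis by (auto intro!: derivative_eq_intros)
qed

lemma gcos_gsin_pythagoras: "(gcos G x)\<^sup>2 + curvature G * (gsin G x)\<^sup>2 = 1"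
  by (cases G) (simp_all add: cosh_square_eq)

lemma gsin_zero [simp]: "gsin G 0 = 0" and gcos_zero [simp]: "gcos G 0 = 1"
  by (cases G; simp)+

text \<open>
  On the hyperbola only the branch with positive first coordinate is parametrised; the whole circle is.
\<close>

lemma gsin_gcos_param:
  assumes "curvature G * \<alpha>\<^sup>2 + \<beta>\<^sup>2 = curvature G" "G = S2 \<or> G = H2" "G = H2 \<Longrightarrow> \<alpha> > 0"
  obtains t where "\<alpha> = gcos G t" "\<beta> = gsin G t"
proof (cases "G = S2")
  case True
  then have "\<alpha>\<^sup>2 + \<beta>\<^sup>2 = 1" using assms by simp
  then obtain t where "\<alpha> = cos t" "\<beta> = sin t" by (rule sincos_total_2pi)
  then show thesis using that[of t] True by simp
next
  case False
  then have G: "G = H2" using assms by simp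
  then have "\<alpha>\<^sup>2 = \<beta>\<^sup>2 + 1" "\<alpha> > 0" using assms by auto
  then have "\<alpha> = cosh (arsinh \<beta>)"
    unfolding cosh_arsinh_real by (metis less_eq_real_def real_sqrt_unique)
  then show thesis using that[of "arsinh \<beta>"] G by simp
qed

text \<open>
  The system \<open>f' = h\<close>, \<open>h' = - \<kappa> f\<close> is a rotation for \<open>\<kappa> = 1\<close>, a hyperbolic rotation for
  \<open>\<kappa> = -1\<close> and a shear for \<open>\<kappa> = 0\<close>. Applying the inverse motion to \<open>(f, h)\<close> yields two conserved
  quantities; evaluating them at \<open>s\<close> and solving for \<open>f\<close> gives the solution.
\<close>

lemma gsin_ode:
  fixes f h :: "real \<Rightarrow> 'a::real_normed_vector"
  assumes f: "\<And>t. (f has_vector_derivative h t) (at t)"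
    and h: "\<And>t. (h has_vector_derivative - curvature G *\<^sub>R f t) (at t)"
    and "f s = 0"
  shows "f t = gsin G (t - s) *\<^sub>R h s"
proof -
  define C S where "C = (\<lambda>t. gcos G (t - s))" and "S = (\<lambda>t. gsin G (t - s))"
  have C: "(C has_real_derivative - curvature G * S t) (at t)" for t
    unfolding C_def S_def
    using DERIV_shift[of "gcos G" _ t "- s"] gcos_deriv[of G "t - s"] by simp
  have S: "(S has_real_derivative C t) (at t)" for t
    unfolding C_def S_def
    using DERIV_shift[of "gsin G" _ t "- s"] gsin_deriv[of G "t - s"] by simp
  have "((\<lambda>t. C t *\<^sub>R f t - S t *\<^sub>R h t) has_vector_derivative 0) (at t within UNIV)" for t
    by (rule derivative_eq_intros C S f h refl)+ (simp add: algebra_simps)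
  from has_vector_derivative_zero_constant[OF convex_UNIV this]
  obtain c1 where c1: "C t *\<^sub>R f t - S t *\<^sub>R h t = c1" for t by auto
  have "((\<lambda>t. C t *\<^sub>R h t + (curvature G * S t) *\<^sub>R f t) has_vector_derivative 0) (at t within UNIV)" for t
    by (rule derivative_eq_intros C S f h refl)+ (simp add: algebra_simps)
  from has_vector_derivative_zero_constant[OF convex_UNIV this]
  obtain c2 where c2: "C t *\<^sub>R h t + (curvature G * S t) *\<^sub>R f t = c2" for t by auto
  have "c1 = 0" "c2 = h s"
    using c1[of s] c2[of s] \<open>f s = 0\<close> by (simp_all add: C_def S_def)
  then have e: "C t *\<^sub>R f t = S t *\<^sub>R h t" "(curvature G * S t) *\<^sub>R f t = h s - C t *\<^sub>R h t"
    using c1[of t] c2[of t] by (auto simp: algebra_simps)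
  have "f t = ((C t)\<^sup>2 + curvature G * (S t)\<^sup>2) *\<^sub>R f t"
    by (simp add: C_def S_def gcos_gsin_pythagoras)
  also have "\<dots> = C t *\<^sub>R (C t *\<^sub>R f t) + S t *\<^sub>R ((curvature G * S t) *\<^sub>R f t)"
    by (simp add: algebra_simps power2_eq_square)
  also have "\<dots> = S t *\<^sub>R h s"
    unfolding e by (simp add: algebra_simps)
  finally show ?thesis by (simp add: S_def)
qed

lemma continuous_unit_square_constant:
  fixes e :: "real \<Rightarrow> real"
  assumes "continuous_on UNIV e" "\<And>t. (e t)\<^sup>2 = 1"
  shows "e s = e t"
proof -
  have "range e \<subseteq> {1, -1}" using assms(2) by (auto simp: power2_eq_1_iff)
  then have "finite (range e)" using finite_subset by blast
  then have "e constant_on UNIV"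
    by (intro continuous_finite_range_constant assms) auto
  then show ?thesis by (auto simp: constant_on_def)
qed

section \<open>The ambient bilinear forms\<close>

lemma bounded_bilinear_cross3: "bounded_bilinear cross3"
  using bilinear_cross bilinear_conv_bounded_bilinear by blast

lemma bounded_bilinear_metric_form: "bounded_bilinear (metric_form G)"
proof (cases G)
  case H2
  have "bilinear minkowski"
    unfolding bilinear_def minkowski_def by (auto intro!: linearI simp: algebra_simps)
  then show ?thesis using H2 bilinear_conv_bounded_bilinear by auto
qed (auto intro: bounded_bilinear_inner)

lemma metric_form_commute: "metric_form G x y = metric_form G y x"
  by (cases G) (auto simp: minkowski_def inner_commute)

lemmas metric_form_simps =
  bounded_bilinear.add_left[OF bounded_bilinear_metric_form]
  bounded_bilinear.add_right[OF bounded_bilinear_metric_form]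
  bounded_bilinear.diff_left[OF bounded_bilinear_metric_form]
  bounded_bilinear.diff_right[OF bounded_bilinear_metric_form]
  bounded_bilinear.scaleR_left[OF bounded_bilinear_metric_form]
  bounded_bilinear.scaleR_right[OF bounded_bilinear_metric_form]
  bounded_bilinear.zero_left[OF bounded_bilinear_metric_form]
  bounded_bilinear.zero_right[OF bounded_bilinear_metric_form]

lemma metric_form_surface:
  assumes "G = S2 \<or> G = H2" "x \<in> surface G"
  shows "metric_form G x x = curvature G"
  using assms by (auto simp: minkowski_def inner_vec_def sum_3 power2_eq_square)

lemma Cauchy_Schwarz_two:
  fixes a b c d :: real
  shows "(a * c + b * d)\<^sup>2 \<le> (a\<^sup>2 + b\<^sup>2) * (c\<^sup>2 + d\<^sup>2)"
  using zero_le_power2[of "a * d - b * c"] by (simp add: power2_eq_square algebra_simps)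

text \<open>
  Reversed Cauchy-Schwarz: were \<open>x\<close> not spacelike, its third coordinate would dominate the other
  two, and so it could not be Minkowski orthogonal to the timelike vector \<open>A\<close>.
\<close>

lemma hyperbolic_tangent_spacelike:
  assumes "A \<in> surface H2" "minkowski A x = 0" "x \<noteq> 0"
  shows "minkowski x x > 0"
proof (rule ccontr)
  assume "\<not> minkowski x x > 0"
  then have le: "(x$1)\<^sup>2 + (x$2)\<^sup>2 \<le> (x$3)\<^sup>2" by (simp add: minkowski_def power2_eq_square)
  have A: "(A$1)\<^sup>2 + (A$2)\<^sup>2 = (A$3)\<^sup>2 - 1" using assms by simp
  have "A$1 * x$1 + A$2 * x$2 = A$3 * x$3" using assms by (simp add: minkowski_def)
  then have "(A$3)\<^sup>2 * (x$3)\<^sup>2 = (A$1 * x$1 + A$2 * x$2)\<^sup>2" by (simp add: power_mult_distrib)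
  also have "\<dots> \<le> ((A$1)\<^sup>2 + (A$2)\<^sup>2) * ((x$1)\<^sup>2 + (x$2)\<^sup>2)"
    by (rule Cauchy_Schwarz_two)
  also have "\<dots> \<le> ((A$1)\<^sup>2 + (A$2)\<^sup>2) * (x$3)\<^sup>2"
    using le by (intro mult_left_mono) auto
  also have "\<dots> = (A$3)\<^sup>2 * (x$3)\<^sup>2 - (x$3)\<^sup>2" unfolding A by (simp add: algebra_simps)
  finally have "x$3 = 0" by simp
  with le have "x$1 = 0" "x$2 = 0" by (auto simp: sum_power2_le_zero_iff)
  with \<open>x$3 = 0\<close> have "x = 0" by (simp add: vec_eq_iff forall_3)
  with assms show False by simp
qed

lemma metric_form_tangent_pos:
  assumes "G = S2 \<or> G = H2" "A \<in> surface G" "metric_form G A x = 0" "x \<noteq> 0"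
  shows "metric_form G x x > 0"
  using assms hyperbolic_tangent_spacelike by auto

lemma hyperbolic_sheet_neg:
  assumes "A \<in> surface H2" "B \<in> surface H2"
  shows "minkowski A B < 0"
proof -
  have A: "(A$1)\<^sup>2 + (A$2)\<^sup>2 = (A$3)\<^sup>2 - 1" "A$3 > 0" using assms by auto
  have B: "(B$1)\<^sup>2 + (B$2)\<^sup>2 = (B$3)\<^sup>2 - 1" "B$3 > 0" using assms by auto
  have "(A$1 * B$1 + A$2 * B$2)\<^sup>2 \<le> ((A$1)\<^sup>2 + (A$2)\<^sup>2) * ((B$1)\<^sup>2 + (B$2)\<^sup>2)"
    by (rule Cauchy_Schwarz_two)
  also have "\<dots> = ((A$3)\<^sup>2 - 1) * ((B$3)\<^sup>2 - 1)" by (simp only: A B)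
  also have "\<dots> < (A$3 * B$3)\<^sup>2"
  proof -
    have "(A$3)\<^sup>2 \<ge> 1" "(B$3)\<^sup>2 > 0"
      using A B zero_le_power2[of "A$1"] zero_le_power2[of "A$2"] by (linarith, simp)
    then have "1 < (A$3)\<^sup>2 + (B$3)\<^sup>2" by linarith
    then show ?thesis by (simp add: algebra_simps power_mult_distrib)
  qed
  finally have "A$1 * B$1 + A$2 * B$2 < A$3 * B$3"
    by (rule power_less_imp_less_base) (use A B in simp)
  then show ?thesis by (simp add: minkowski_def)
qed

text \<open>
  The condition selecting the upper sheet can be tested against any point of the sheet instead of
  the third coordinate: the lower sheet consists of the negatives of the points of the upper one.
  In this form it is immediate for linear combinations of an orthonormal frame.
\<close>

lemma surface_iff:
  assumes "G = S2 \<or> G = H2" "A \<in> surface G"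
  shows "x \<in> surface G \<longleftrightarrow>
    metric_form G x x = curvature G \<and> (G = H2 \<longrightarrow> metric_form G A x < 0)"
proof (cases "G = H2")
  case False
  then show ?thesis using assms by (auto simp: inner_vec_def sum_3 power2_eq_square)
next
  case True
  show ?thesis
  proof
    assume "x \<in> surface G"
    then show "metric_form G x x = curvature G \<and> (G = H2 \<longrightarrow> metric_form G A x < 0)"
      using assms True metric_form_surface[of G x] hyperbolic_sheet_neg[of A x] by auto
  next
    assume a: "metric_form G x x = curvature G \<and> (G = H2 \<longrightarrow> metric_form G A x < 0)"
    then have x: "(x$1)\<^sup>2 + (x$2)\<^sup>2 - (x$3)\<^sup>2 = -1" "minkowski A x < 0"
      using True by (auto simp: minkowski_def power2_eq_square)
    have "x$3 > 0"
    proof (rule ccontr)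
      assume "\<not> x$3 > 0"
      moreover have "x$3 \<noteq> 0"
        using x(1) zero_le_power2[of "x$1"] zero_le_power2[of "x$2"] by (intro notI) simp
      ultimately have "-x \<in> surface H2" using x(1) by simp
      then have "minkowski A (-x) < 0" using assms True hyperbolic_sheet_neg by blast
      then show False using x(2) by (simp add: minkowski_def)
    qed
    then show "x \<in> surface G" using x True by simp
  qed
qed

text \<open>
  The usual expansion in an orthonormal basis. The factor \<open>\<kappa>\<close> compensates for \<open>u\<close> having square
  \<open>\<kappa> = \<plusminus>1\<close>, since \<open>1 / \<kappa> = \<kappa>\<close>.
\<close>

lemma frame_expansion:
  assumes G: "G = S2 \<or> G = H2" and P: "subspace P" "dim P = 2" "u \<in> P" "v \<in> P" "x \<in> P"
    and f: "metric_form G u u = curvature G" "metric_form G u v = 0" "metric_form G v v = 1"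
  shows "x = (curvature G * metric_form G x u) *\<^sub>R u + metric_form G x v *\<^sub>R v"
proof -
  have k: "curvature G * curvature G = 1" using G by auto
  have "u \<noteq> v" using f by auto
  have "v \<noteq> 0" using f by (auto simp: metric_form_simps)
  have "u \<notin> span {v}"
  proof
    assume "u \<in> span {v}"
    then obtain c where "u = c *\<^sub>R v" by (auto simp: span_singleton)
    then show False using f k by (auto simp: metric_form_simps)
  qed
  then have "independent {u, v}" using \<open>v \<noteq> 0\<close> \<open>u \<noteq> v\<close> by (simp add: independent_insert)
  then have "P \<subseteq> span {u, v}"
    using P \<open>u \<noteq> v\<close> by (intro card_ge_dim_independent) auto
  then have "x \<in> span {u, v}" using P by blast
  then obtain a b where x: "x = a *\<^sub>R u + b *\<^sub>R v"
    by (auto simp: span_insert span_singleton algebra_simps)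
  have "metric_form G x u = curvature G * a" "metric_form G x v = b"
    unfolding x using f by (auto simp: metric_form_simps metric_form_commute[of G v u])
  then show ?thesis using x k by (metis mult.assoc mult_1)
qed

lemma curved_geo_line_plane:
  assumes "G = S2 \<or> G = H2" "L \<in> geo_lines G"
  obtains P where "subspace P" "dim P = 2" "L = surface G \<inter> P"
proof (cases "G = S2")
  case True
  then show thesis using assms(2) that unfolding True geo_lines.simps by blast
next
  case False
  then have "G = H2" using assms(1) by simp
  then show thesis using assms(2) that unfolding \<open>G = H2\<close> geo_lines.simps by blast
qed

section \<open>Generalized sines as areas\<close>

lemma derivative_in_subspace:
  fixes \<gamma> :: "real \<Rightarrow> 'a::euclidean_space"
  assumes "subspace P" "\<And>t. \<gamma> t \<in> P" "(\<gamma> has_vector_derivative d) (at t)"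
  shows "d \<in> P"
proof -
  obtain y z where y: "y \<in> span P" and z: "\<And>w. w \<in> span P \<Longrightarrow> orthogonal z w" and d: "d = y + z"
    using orthogonal_subspace_decomp_exists by blast
  have P: "span P = P" using assms(1) by (simp add: span_eq_iff)
  have "((\<lambda>t. z \<bullet> \<gamma> t) has_vector_derivative z \<bullet> d) (at t)"
    by (rule bounded_linear.has_vector_derivative[OF bounded_linear_inner_right assms(3)])
  moreover have "(\<lambda>t. z \<bullet> \<gamma> t) = (\<lambda>t. 0)"
    using z assms(2) P by (auto simp: orthogonal_def)
  ultimately have "z \<bullet> d = 0"
    by (metis has_vector_derivative_const vector_derivative_unique_at)
  moreover have "z \<bullet> y = 0" using z y by (auto simp: orthogonal_def)
  ultimately have "z = 0" by (simp add: d inner_add_right)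
  then show ?thesis using d y P by simp
qed

text \<open>
  The pair \<open>\<gamma> t\<close>, \<open>\<gamma>' t\<close> is an orthonormal frame of the plane of the line, so two such frames
  differ by a transformation of determinant \<open>\<plusminus>1\<close>. By continuity the sign is constant, and hence so
  is the area \<open>D = \<gamma> t \<times> \<gamma>' t\<close>. Expanding \<open>\<gamma> s\<close> in the frame at \<open>t\<close> expresses both
  \<open>\<gamma> s \<times> \<gamma> t\<close> and its derivative \<open>\<gamma> s \<times> \<gamma>' t\<close> as multiples of \<open>D\<close>, with coefficients
  that are products of \<open>\<gamma> s\<close> with \<open>\<gamma>' t\<close> and \<open>\<gamma> t\<close>; thus they solve the equation of the
  generalized sine. Differentiating \<open>\<gamma> t \<times> \<gamma>' t\<close> to see that it is constant would require a second derivative, which \<open>\<gamma>\<close> is not assumed to have.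
\<close>

lemma unit_speed_cross3:
  assumes G: "G = S2 \<or> G = H2" and P: "subspace P" "dim P = 2"
    and on: "\<And>t. \<gamma> t \<in> surface G \<inter> P"
    and cont: "continuous_on UNIV \<gamma>'"
    and deriv: "\<And>t. (\<gamma> has_vector_derivative \<gamma>' t) (at t)"
    and unit: "\<And>t. metric_form G (\<gamma>' t) (\<gamma>' t) = 1"
  shows "\<exists>K. \<forall>s t. cross3 (\<gamma> s) (\<gamma> t) = gsin G (t - s) *\<^sub>R K"
proof -
  let ?B = "metric_form G" and ?\<kappa> = "curvature G"
  interpret B: bounded_bilinear ?B by (rule bounded_bilinear_metric_form)
  interpret X: bounded_bilinear cross3 by (rule bounded_bilinear_cross3)
  have k: "?\<kappa> * ?\<kappa> = 1" using G by auto
  have norm: "?B (\<gamma> t) (\<gamma> t) = ?\<kappa>" for t using metric_form_surface[OF G] on by auto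
  have inP: "\<gamma> t \<in> P" "\<gamma>' t \<in> P" for t
    using on derivative_in_subspace[OF P(1) _ deriv] by auto
  have orth: "?B (\<gamma> t) (\<gamma>' t) = 0" for t
  proof -
    have "((\<lambda>t. ?B (\<gamma> t) (\<gamma> t)) has_vector_derivative ?B (\<gamma> t) (\<gamma>' t) + ?B (\<gamma>' t) (\<gamma> t)) (at t)"
      by (rule B.has_vector_derivative[OF deriv deriv])
    moreover have "(\<lambda>t. ?B (\<gamma> t) (\<gamma> t)) = (\<lambda>t. ?\<kappa>)" using norm by auto
    ultimately have "?B (\<gamma> t) (\<gamma>' t) + ?B (\<gamma>' t) (\<gamma> t) = 0"
      by (metis has_vector_derivative_const vector_derivative_unique_at)
    then show ?thesis by (simp add: metric_form_commute[of G "\<gamma>' t"])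
  qed
  note frame = frame_expansion[OF G P inP _ norm orth unit]
  \<comment> \<open>the determinant of the change from the frame at \<open>0\<close> to the frame at \<open>t\<close>, visibly continuous in \<open>t\<close>\<close>
  define e where "e t = ?\<kappa> * (?B (\<gamma> t) (\<gamma> 0) * ?B (\<gamma>' t) (\<gamma>' 0)
      - ?B (\<gamma> t) (\<gamma>' 0) * ?B (\<gamma>' t) (\<gamma> 0))" for t
  define K where "K = cross3 (\<gamma> 0) (\<gamma>' 0)"
  have e: "cross3 (\<gamma> t) (\<gamma>' t) = e t *\<^sub>R K" for t
  proof -
    let ?a = "?\<kappa> * ?B (\<gamma> t) (\<gamma> 0)" and ?b = "?B (\<gamma> t) (\<gamma>' 0)"
    let ?c = "?\<kappa> * ?B (\<gamma>' t) (\<gamma> 0)" and ?d = "?B (\<gamma>' t) (\<gamma>' 0)"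
    have "cross3 (\<gamma> t) (\<gamma>' t)
        = cross3 (?a *\<^sub>R \<gamma> 0 + ?b *\<^sub>R \<gamma>' 0) (?c *\<^sub>R \<gamma> 0 + ?d *\<^sub>R \<gamma>' 0)"
      using frame[OF inP(1), of t 0] frame[OF inP(2), of t 0] by simp
    also have "\<dots> = e t *\<^sub>R K"
      unfolding K_def e_def
      by (simp add: X.add_left X.add_right X.scaleR_left X.scaleR_right cross_skew[of "\<gamma>' 0" "\<gamma> 0"]
          algebra_simps)
    finally show ?thesis .
  qed
  have e2: "(e t)\<^sup>2 = 1" for t
  proof -
    define a b c d where "a = ?\<kappa> * ?B (\<gamma> t) (\<gamma> 0)" and "b = ?B (\<gamma> t) (\<gamma>' 0)"
      and "c = ?\<kappa> * ?B (\<gamma>' t) (\<gamma> 0)" and "d = ?B (\<gamma>' t) (\<gamma>' 0)"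
    have g: "\<gamma> t = a *\<^sub>R \<gamma> 0 + b *\<^sub>R \<gamma>' 0" "\<gamma>' t = c *\<^sub>R \<gamma> 0 + d *\<^sub>R \<gamma>' 0"
      using frame[OF inP(1), of t 0] frame[OF inP(2), of t 0]
      unfolding a_def b_def c_def d_def by blast+
    have "?\<kappa> * a\<^sup>2 + b\<^sup>2 = ?\<kappa>"
      using norm[of t] norm[of 0] orth[of 0] unit[of 0] unfolding g
      by (simp add: metric_form_simps metric_form_commute[of G "\<gamma>' 0" "\<gamma> 0"] power2_eq_square
          algebra_simps)
    moreover have "?\<kappa> * c\<^sup>2 + d\<^sup>2 = 1"
      using unit[of t] norm[of 0] orth[of 0] unit[of 0] unfolding g
      by (simp add: metric_form_simps metric_form_commute[of G "\<gamma>' 0" "\<gamma> 0"] power2_eq_square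
          algebra_simps)
    moreover have "?\<kappa> * a * c + b * d = 0"
      using orth[of t] norm[of 0] orth[of 0] unit[of 0] unfolding g
      by (simp add: metric_form_simps metric_form_commute[of G "\<gamma>' 0" "\<gamma> 0"] power2_eq_square
          algebra_simps)
    \<comment> \<open>the Gram determinant is the squared determinant of the change of frame times \<open>\<kappa>\<close>\<close>
    moreover have "(?\<kappa> * a\<^sup>2 + b\<^sup>2) * (?\<kappa> * c\<^sup>2 + d\<^sup>2) - (?\<kappa> * a * c + b * d)\<^sup>2
        = ?\<kappa> * (a * d - b * c)\<^sup>2"
      by (simp add: power2_eq_square algebra_simps)
    ultimately have "?\<kappa> * (a * d - b * c)\<^sup>2 = ?\<kappa>" by simp
    moreover have "e t = a * d - b * c"
      by (simp add: e_def a_def b_def c_def d_def algebra_simps)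
    ultimately show ?thesis using k by auto
  qed
  have "continuous_on UNIV \<gamma>"
    using deriv has_vector_derivative_continuous
    by (metis continuous_at_imp_continuous_on)
  then have "continuous_on UNIV e"
    unfolding e_def by (intro continuous_intros B.continuous_on cont)
  then have K: "cross3 (\<gamma> t) (\<gamma>' t) = e 0 *\<^sub>R K" for t
    using e[of t] continuous_unit_square_constant[of e t 0] e2 by simp
  have "cross3 (\<gamma> s) (\<gamma> t) = gsin G (t - s) *\<^sub>R (e 0 *\<^sub>R K)" for s t
  proof -
    define D where "D = e 0 *\<^sub>R K"
    define h where "h t = (?\<kappa> * ?B (\<gamma> s) (\<gamma> t)) *\<^sub>R D" for t
    have "cross3 (\<gamma> s) (\<gamma>' t) = h t" for t
      using K[of t] unfolding D_def[symmetric] h_def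
      by (subst frame[OF inP(1), of s t]) (simp add: X.add_left X.scaleR_left)
    then have f: "((\<lambda>t. cross3 (\<gamma> s) (\<gamma> t)) has_vector_derivative h t) (at t)" for t
      using bounded_linear.has_vector_derivative[OF X.bounded_linear_right deriv] by metis
    have "cross3 (\<gamma> s) (\<gamma> t) = - ?B (\<gamma> s) (\<gamma>' t) *\<^sub>R D" for t
      using K[of t] unfolding D_def[symmetric]
      by (subst frame[OF inP(1), of s t])
        (simp add: X.add_left X.scaleR_left cross_skew[of "\<gamma>' t" "\<gamma> t"])
    then have "(?\<kappa> * ?B (\<gamma> s) (\<gamma>' t)) *\<^sub>R D = - ?\<kappa> *\<^sub>R cross3 (\<gamma> s) (\<gamma> t)" for t
      by simp
    moreover have "(h has_vector_derivative (?\<kappa> * ?B (\<gamma> s) (\<gamma>' t)) *\<^sub>R D) (at t)" for t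
    proof -
      have "bounded_linear (\<lambda>x. (?\<kappa> * ?B (\<gamma> s) x) *\<^sub>R D)"
        by (intro bounded_linear_scaleR_const bounded_linear_const_mult B.bounded_linear_right)
      then show ?thesis unfolding h_def
        by (rule bounded_linear.has_vector_derivative) (rule deriv)
    qed
    ultimately have h: "(h has_vector_derivative - ?\<kappa> *\<^sub>R cross3 (\<gamma> s) (\<gamma> t)) (at t)" for t
      by metis
    have "cross3 (\<gamma> s) (\<gamma> t) = gsin G (t - s) *\<^sub>R h s"
      by (rule gsin_ode[OF f h]) simp
    also have "h s = D" using norm k by (simp add: h_def)
    finally show ?thesis by (simp add: D_def)
  qed
  then show ?thesis by blast
qed

text \<open>
  The velocity is a multiple of the direction of the line. Its length fixes the factor up to a sign,
  and the sign cannot change by continuity, so the velocity is constant.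
\<close>

lemma euclidean_unit_speed:
  assumes "affine L" "aff_dim L = 1" and on: "\<And>t. \<gamma> t \<in> L"
    and cont: "continuous_on UNIV \<gamma>'"
    and deriv: "\<And>t. (\<gamma> has_vector_derivative \<gamma>' t) (at t)"
    and unit: "\<And>t. \<gamma>' t \<bullet> \<gamma>' t = 1"
  shows "\<exists>v. \<forall>t. \<gamma> t = \<gamma> 0 + t *\<^sub>R (v::'a::euclidean_space)"
proof -
  have "collinear L" using assms by (simp add: collinear_aff_dim)
  then obtain u where u: "\<And>x y. x \<in> L \<Longrightarrow> y \<in> L \<Longrightarrow> \<exists>c. x - y = c *\<^sub>R u"
    unfolding collinear_def by blast
  define c where "c x = (x \<bullet> u) / (u \<bullet> u)" for x
  have lin: "bounded_linear c" unfolding c_def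
    by (intro bounded_linear_divide bounded_linear_inner_left bounded_linear_compose[of "\<lambda>x. x / (u \<bullet> u)"])
  have c: "\<gamma> t = \<gamma> 0 + c (\<gamma> t - \<gamma> 0) *\<^sub>R u" for t
    using u[OF on on, of t 0] by (auto simp: c_def algebra_simps)
  have "((\<lambda>t. \<gamma> 0 + c (\<gamma> t - \<gamma> 0) *\<^sub>R u) has_vector_derivative c (\<gamma>' t) *\<^sub>R u) (at t)" for t
  proof -
    have "bounded_linear (\<lambda>x. c x *\<^sub>R u)" using lin by (rule bounded_linear_scaleR_const)
    moreover have "((\<lambda>t. \<gamma> t - \<gamma> 0) has_vector_derivative \<gamma>' t) (at t)"
      using has_vector_derivative_diff[OF deriv[of t] has_vector_derivative_const[of "\<gamma> 0"]] by simp
    ultimately have "((\<lambda>t. c (\<gamma> t - \<gamma> 0) *\<^sub>R u) has_vector_derivative c (\<gamma>' t) *\<^sub>R u) (at t)"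
      by (rule bounded_linear.has_vector_derivative)
    then show ?thesis
      using has_vector_derivative_add[OF has_vector_derivative_const] by force
  qed
  then have d: "\<gamma>' t = c (\<gamma>' t) *\<^sub>R u" for t
    using deriv[of t] c by (metis (no_types, lifting) ext vector_derivative_unique_at)
  define e where "e t = c (\<gamma>' t) * norm u" for t
  have "(e t)\<^sup>2 = 1" for t
    using unit[of t] d[of t] unfolding e_def
    by (metis inner_scaleR_left inner_scaleR_right mult.assoc power2_eq_square power2_norm_eq_inner power_mult_distrib)
  moreover have "continuous_on UNIV e" unfolding e_def
    by (intro continuous_intros bounded_linear.continuous_on[OF lin] cont)
  ultimately have "e t = e 0" for t by (rule continuous_unit_square_constant[rotated])
  moreover have "u \<noteq> 0" by (metis d unit inner_zero_left scaleR_zero_right zero_neq_one)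
  ultimately have "c (\<gamma>' t) = c (\<gamma>' 0)" for t by (simp add: e_def)
  then have g: "\<gamma>' t = \<gamma>' 0" for t using d by metis
  have "((\<lambda>t. \<gamma> t - t *\<^sub>R \<gamma>' 0) has_vector_derivative 0) (at t within UNIV)" for t
    by (rule derivative_eq_intros deriv refl)+ (simp add: g[of t])
  from has_vector_derivative_zero_constant[OF convex_UNIV this]
  obtain z where "\<gamma> t - t *\<^sub>R \<gamma>' 0 = z" for t by auto
  then have "\<gamma> t = \<gamma> 0 + t *\<^sub>R \<gamma>' 0" for t
    by (metis add.commute diff_add_cancel diff_zero scaleR_zero_left)
  then show ?thesis by blast
qed

text \<open>
  In the Euclidean case the identity is \<open>(p + s v) \<times> (p + t v) = (t - s) (p \<times> v)\<close>. The vector \<open>K\<close>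
  vanishes there if the line passes through the origin, so \<open>K \<noteq> 0\<close> has to be established where \<open>K\<close> is
  to be cancelled.
\<close>

lemma oriented_line_cross3:
  assumes "oriented_line G \<gamma>"
  shows "\<exists>K. \<forall>s t. cross3 (\<gamma> s) (\<gamma> t) = gsin G (t - s) *\<^sub>R K"
proof -
  obtain \<gamma>' where cont: "continuous_on UNIV \<gamma>'"
    and deriv: "\<And>t. (\<gamma> has_vector_derivative \<gamma>' t) (at t)"
    and unit: "\<And>t. metric_form G (\<gamma>' t) (\<gamma>' t) = 1" and L: "range \<gamma> \<in> geo_lines G"
    using assms by (auto simp: oriented_line_def)
  show ?thesis
  proof (cases "G = S2 \<or> G = H2")
    case True
    then obtain P where "subspace P" "dim P = 2" "range \<gamma> = surface G \<inter> P"
      using curved_geo_line_plane L by metis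
    then show ?thesis by (intro unit_speed_cross3[OF True _ _ _ cont deriv unit]) auto
  next
    case False
    then obtain w where G: "G = E2 w" by (cases G) auto
    then have "affine (range \<gamma>)" "aff_dim (range \<gamma>) = 1" using L by auto
    then obtain v where v: "\<gamma> t = \<gamma> 0 + t *\<^sub>R v" for t
      using euclidean_unit_speed[OF _ _ _ cont deriv] unit G by (metis metric_form.simps(3) rangeI)
    have "cross3 (\<gamma> s) (\<gamma> t) = (t - s) *\<^sub>R cross3 (\<gamma> 0) v" for s t
    proof -
      interpret X: bounded_bilinear cross3 by (rule bounded_bilinear_cross3)
      show ?thesis
        by (subst v[of s], subst v[of t])
          (simp add: X.add_left X.add_right X.scaleR_left X.scaleR_right cross_skew[of v "\<gamma> 0"]
            algebra_simps)
    qed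
    then show ?thesis using G by auto
  qed
qed


section \<open>The cross-ratio in terms of areas\<close>

definition area_cross_ratio :: "real^3 \<Rightarrow> real^3 \<Rightarrow> real^3 \<Rightarrow> real^3 \<Rightarrow> real^3 \<Rightarrow> real" where
  "area_cross_ratio N A B C D =
     (N \<bullet> cross3 A C) / (N \<bullet> cross3 A D) * ((N \<bullet> cross3 B D) / (N \<bullet> cross3 B C))"

lemma area_cross_ratio_scale:
  assumes "a \<noteq> 0" "b \<noteq> 0" "c \<noteq> 0" "d \<noteq> 0"
  shows "area_cross_ratio N (a *\<^sub>R A) (b *\<^sub>R B) (c *\<^sub>R C) (d *\<^sub>R D) = area_cross_ratio N A B C D"
  using assms
  by (simp add: area_cross_ratio_def bounded_bilinear.scaleR_left[OF bounded_bilinear_cross3]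
      bounded_bilinear.scaleR_right[OF bounded_bilinear_cross3])

text \<open>
  The assumption on \<open>a\<close> and \<open>b\<close> merely certifies \<open>N \<bullet> K \<noteq> 0\<close>, which is what allows \<open>K\<close> to be
  cancelled. Stating it through two points of the line leaves \<open>K\<close>, which depends on the orientation, out
  of the statement.
\<close>

lemma gsin_ratio_eq_area_cross_ratio:
  assumes "oriented_line G \<gamma>" "N \<bullet> cross3 (\<gamma> a) (\<gamma> b) \<noteq> 0"
  shows "gsin G (c - a) / gsin G (d - a) * (gsin G (d - b) / gsin G (c - b))
    = area_cross_ratio N (\<gamma> a) (\<gamma> b) (\<gamma> c) (\<gamma> d)"
proof -
  obtain K where K: "\<And>s t. cross3 (\<gamma> s) (\<gamma> t) = gsin G (t - s) *\<^sub>R K"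
    using oriented_line_cross3[OF assms(1)] by blast
  have "N \<bullet> K \<noteq> 0" using assms(2) by (simp add: K)
  then show ?thesis by (simp add: area_cross_ratio_def K)
qed

lemma cross_ratio_eq_area_cross_ratio:
  assumes "oriented_line G \<gamma>" "{A, B, C, D} \<subseteq> range \<gamma>" "N \<bullet> cross3 A B \<noteq> 0"
  shows "cross_ratio G A B C D = area_cross_ratio N A B C D"
  unfolding cross_ratio_def
proof (rule the_equality)
  obtain a b c d where "\<gamma> a = A" "\<gamma> b = B" "\<gamma> c = C" "\<gamma> d = D" using assms(2) by auto
  then show "\<exists>\<gamma> a b c d. oriented_line G \<gamma> \<and> \<gamma> a = A \<and> \<gamma> b = B \<and> \<gamma> c = C \<and> \<gamma> d = D \<and>
      area_cross_ratio N A B C D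
        = gsin G (c - a) / gsin G (d - a) * (gsin G (d - b) / gsin G (c - b))"
    using assms gsin_ratio_eq_area_cross_ratio by metis
next
  fix r
  assume "\<exists>\<gamma> a b c d. oriented_line G \<gamma> \<and> \<gamma> a = A \<and> \<gamma> b = B \<and> \<gamma> c = C \<and> \<gamma> d = D \<and>
      r = gsin G (c - a) / gsin G (d - a) * (gsin G (d - b) / gsin G (c - b))"
  then show "r = area_cross_ratio N A B C D"
    using assms(3) gsin_ratio_eq_area_cross_ratio by metis
qed

section \<open>Existence of oriented lines\<close>

text \<open>
  Parallel points of the surface differ by a factor \<open>\<plusminus>1\<close>, because the quadratic form takes the same
  nonzero value at both. For distinct points the factor is \<open>-1\<close>, which
  the upper sheet of the hyperboloid excludes.
\<close>

lemma antipodal_if_parallel: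
  assumes G: "G = S2 \<or> G = H2" and AB: "A \<in> surface G" "B \<in> surface G" "A \<noteq> B"
    and "cross3 A B = 0"
  shows "antipodal G A B"
proof -
  have k: "curvature G \<noteq> 0" using G by auto
  have nn: "metric_form G A A = curvature G" "metric_form G B B = curvature G"
    using G AB metric_form_surface by blast+
  then have "A \<noteq> 0" "B \<noteq> 0" using k by (auto simp: metric_form_simps)
  then obtain c where c: "B = c *\<^sub>R A" using assms cross_eq_0 collinear_lemma by metis
  have unit: "c = 1 \<or> c = -1" if "metric_form G (c *\<^sub>R A) (c *\<^sub>R A) = curvature G" for c
    using that nn k by (auto simp: metric_form_simps square_eq_1_iff)
  then have B: "B = -A" using c nn AB by fastforce
  have "G = S2" using G AB B by auto
  have "surface G \<inter> span {A} = {A, B}"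
  proof
    show "surface G \<inter> span {A} \<subseteq> {A, B}"
      using unit metric_form_surface[OF G] B by (fastforce simp: span_singleton)
    show "{A, B} \<subseteq> surface G \<inter> span {A}"
      using AB B by (auto simp: span_base span_neg)
  qed
  moreover have "dim (span {A}) = 1" using \<open>A \<noteq> 0\<close> by (simp add: dim_span)
  ultimately show ?thesis using AB unfolding antipodal_def by blast
qed

text \<open>
  Orthogonalising \<open>B\<close> against \<open>A\<close> gives a unit tangent vector \<open>v\<close> at \<open>A\<close>, and the line is traversed
  by \<open>gcos t A + gsin t v\<close>. On the hyperboloid \<open>v\<close> can be normalised because vectors tangent to it are
  spacelike. Every point of the section is reached, by expanding it in the frame \<open>A\<close>, \<open>v\<close>.
\<close>

lemma oriented_line_exists:
  assumes G: "G = S2 \<or> G = H2" and P: "subspace P" "dim P = 2"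
    and A: "A \<in> surface G" "A \<in> P" and B: "B \<in> P" "cross3 A B \<noteq> 0"
  shows "\<exists>\<gamma>. oriented_line G \<gamma> \<and> range \<gamma> = surface G \<inter> P"
proof -
  let ?B = "metric_form G" and ?\<kappa> = "curvature G"
  have k: "?\<kappa> * ?\<kappa> = 1" using G by auto
  have AA: "?B A A = ?\<kappa>" using metric_form_surface[OF G A(1)] .
  define y where "y = B - (?\<kappa> * ?B A B) *\<^sub>R A"
  have "y \<in> P" unfolding y_def using P A B by (simp add: subspace_diff subspace_scale)
  have "?B A y = 0" using AA k by (simp add: y_def metric_form_simps)
  have "y \<noteq> 0"
  proof
    assume "y = 0"
    then have "cross3 A B = cross3 A ((?\<kappa> * ?B A B) *\<^sub>R A)" by (simp add: y_def)
    then show False using B by (simp add: cross_mult_right)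
  qed
  have pos: "?B y y > 0" by (rule metric_form_tangent_pos[OF G A(1)]) fact+
  define v where "v = (1 / sqrt (?B y y)) *\<^sub>R y"
  have v: "v \<in> P" "?B A v = 0" "?B v v = 1"
    using \<open>y \<in> P\<close> P \<open>?B A y = 0\<close> pos by (simp_all add: v_def subspace_scale metric_form_simps)
  define \<gamma> where "\<gamma> t = gcos G t *\<^sub>R A + gsin G t *\<^sub>R v" for t
  define \<gamma>' where "\<gamma>' t = (- ?\<kappa> * gsin G t) *\<^sub>R A + gcos G t *\<^sub>R v" for t
  have deriv: "(\<gamma> has_vector_derivative \<gamma>' t) (at t)" for t
    unfolding \<gamma>_def \<gamma>'_def
    by (rule derivative_eq_intros gsin_deriv gcos_deriv refl)+ simp
  have cont: "continuous_on UNIV \<gamma>'"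
    unfolding \<gamma>'_def
    by (intro continuous_intros DERIV_continuous_on[OF has_field_derivative_at_within[OF gsin_deriv]]
        DERIV_continuous_on[OF has_field_derivative_at_within[OF gcos_deriv]])
  have unit: "?B (\<gamma>' t) (\<gamma>' t) = 1" for t
  proof -
    have "?B (\<gamma>' t) (\<gamma>' t) = ?\<kappa> * (?\<kappa> * ?\<kappa>) * (gsin G t)\<^sup>2 + (gcos G t)\<^sup>2"
      using AA v by (simp add: \<gamma>'_def metric_form_simps metric_form_commute[of G v A] power2_eq_square)
    then show ?thesis using gcos_gsin_pythagoras[of G t] k by simp
  qed
  have range: "range \<gamma> = surface G \<inter> P"
  proof (intro equalityI subsetI)
    fix x assume "x \<in> range \<gamma>"
    then obtain t where x: "x = \<gamma> t" by auto
    have "?B x x = ?\<kappa> * (gcos G t)\<^sup>2 + (gsin G t)\<^sup>2"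
      using AA v by (simp add: x \<gamma>_def metric_form_simps metric_form_commute[of G v A] power2_eq_square)
    also have "\<dots> = ?\<kappa> * ((gcos G t)\<^sup>2 + ?\<kappa> * (gsin G t)\<^sup>2)" using k by (simp add: algebra_simps)
    finally have "?B x x = ?\<kappa>" by (simp add: gcos_gsin_pythagoras)
    moreover have "?B A x < 0" if "G = H2"
      using that AA v by (simp add: x \<gamma>_def metric_form_simps del: metric_form.simps)
    ultimately have "x \<in> surface G" using surface_iff[OF G A(1)] by blast
    moreover have "x \<in> P" using P A v by (simp add: x \<gamma>_def subspace_add subspace_scale)
    ultimately show "x \<in> surface G \<inter> P" by blast
  next
    fix x assume "x \<in> surface G \<inter> P"
    then have x: "?B x x = ?\<kappa>" "G = H2 \<Longrightarrow> ?B A x < 0" "x \<in> P"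
      using surface_iff[OF G A(1)] by blast+
    define \<alpha> \<beta> where "\<alpha> = ?\<kappa> * ?B x A" and "\<beta> = ?B x v"
    have x': "x = \<alpha> *\<^sub>R A + \<beta> *\<^sub>R v"
      unfolding \<alpha>_def \<beta>_def by (rule frame_expansion[OF G P A(2) v(1) x(3) AA v(2,3)])
    have "?\<kappa> * \<alpha>\<^sup>2 + \<beta>\<^sup>2 = ?\<kappa>"
      using x(1) AA v unfolding x'
      by (simp add: metric_form_simps metric_form_commute[of G v A] power2_eq_square algebra_simps)
    moreover have "\<alpha> > 0" if "G = H2"
      using x(2)[OF that] that metric_form_commute[of G x A] by (simp add: \<alpha>_def)
    ultimately obtain t where "\<alpha> = gcos G t" "\<beta> = gsin G t" using gsin_gcos_param G by metis
    then have "x = \<gamma> t" using x' by (simp add: \<gamma>_def)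
    then show "x \<in> range \<gamma>" by blast
  qed
  moreover have "surface G \<inter> P \<in> geo_lines G"
    using G
  proof
    assume "G = S2"
    then show ?thesis using P unfolding \<open>G = S2\<close> geo_lines.simps by blast
  next
    assume "G = H2"
    then show ?thesis using P A unfolding \<open>G = H2\<close> geo_lines.simps by blast
  qed
  ultimately have "oriented_line G \<gamma>"
    unfolding oriented_line_def using deriv cont unit by auto
  then show ?thesis using range by blast
qed

lemma euclidean_oriented_line_exists:
  assumes "affine w" "p \<in> w" "q \<in> w" "p \<noteq> q"
  shows "\<exists>\<gamma>. oriented_line (E2 w) \<gamma> \<and> range \<gamma> = affine hull {p, q}"
proof -
  define \<gamma> where "\<gamma> t = p + t *\<^sub>R sgn (q - p)" for t
  have range: "range \<gamma> = affine hull {p, q}"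
    unfolding affine_hull_2_alt
  proof (intro equalityI subsetI)
    fix x assume "x \<in> range \<gamma>"
    then obtain t where "x = p + (t / norm (q - p)) *\<^sub>R (q - p)"
      by (auto simp: \<gamma>_def sgn_div_norm divide_inverse)
    then show "x \<in> range (\<lambda>u. p + u *\<^sub>R (q - p))" by blast
  next
    fix x assume "x \<in> range (\<lambda>u. p + u *\<^sub>R (q - p))"
    then obtain u where "x = p + u *\<^sub>R (q - p)" by blast
    then have "x = \<gamma> (u * norm (q - p))" using assms(4) by (simp add: \<gamma>_def sgn_div_norm)
    then show "x \<in> range \<gamma>" by blast
  qed
  have "(\<gamma> has_vector_derivative sgn (q - p)) (at t)" for t
    unfolding \<gamma>_def by (rule derivative_eq_intros refl)+ simp
  moreover have "sgn (q - p) \<bullet> sgn (q - p) = 1"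
    using assms(4) by (simp add: dot_square_norm norm_sgn)
  moreover have "affine hull {p, q} \<in> geo_lines (E2 w)"
    using assms hull_minimal[of "{p, q}" w affine] by simp
  ultimately have "oriented_line (E2 w) \<gamma>"
    unfolding oriented_line_def range
    by (intro conjI exI[of _ "\<lambda>_. sgn (q - p)"] continuous_on_const) simp_all
  then show ?thesis using range by blast
qed

section \<open>Central projection\<close>

lemma plane_normal_form:
  assumes "affine w" "aff_dim w = 2" "(0::real^3) \<notin> w"
  obtains m where "w = {x. m \<bullet> x = 1}"
proof -
  have "aff_dim w = int (DIM(real^3) - 1)" using assms by simp
  then obtain a b where "affine hull w = {x. a \<bullet> x = b}"
    unfolding aff_dim_eq_hyperplane by blast
  then have ab: "w = {x. a \<bullet> x = b}" using assms(1) by (simp add: hull_same)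
  have "b \<noteq> 0" using assms(3) ab by auto
  then have "w = {x. (a /\<^sub>R b) \<bullet> x = 1}" using ab by (auto simp: field_simps)
  then show thesis by (rule that)
qed

lemma central_proj_eq:
  assumes w: "w = {x. m \<bullet> x = 1}" and "has_central_proj w P"
  shows "m \<bullet> P \<noteq> 0" "central_proj w P = (1 / (m \<bullet> P)) *\<^sub>R P"
proof -
  have *: "Q = (1 / (m \<bullet> P)) *\<^sub>R P \<and> m \<bullet> P \<noteq> 0" if Q: "Q \<in> w \<inter> span {P}" for Q
  proof -
    obtain c where c: "Q = c *\<^sub>R P" using Q by (auto simp: span_singleton)
    have 1: "c * (m \<bullet> P) = 1" using Q w c by simp
    then have "m \<bullet> P \<noteq> 0" by auto
    then have "c = 1 / (m \<bullet> P)" using 1 by (simp add: eq_divide_eq)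
    then show ?thesis using c \<open>m \<bullet> P \<noteq> 0\<close> by simp
  qed
  obtain Q where Q: "Q \<in> w \<inter> span {P}" using assms(2) by (auto simp: has_central_proj_def)
  then show "m \<bullet> P \<noteq> 0" using * by blast
  show "central_proj w P = (1 / (m \<bullet> P)) *\<^sub>R P"
    unfolding central_proj_def by (rule the_equality) (use Q * in blast)+
qed

text \<open>
  The images of collinear points are collinear: a linear combination of \<open>p\<close> and \<open>q\<close> that lies in
  the plane \<open>m \<bullet> x = 1\<close> through them has coefficients of sum \<open>1\<close>.
\<close>

lemma plane_section_affine_hull:
  assumes P: "subspace P" "dim P = 2" "p \<in> P" "q \<in> P" "x \<in> P"
    and "cross3 p q \<noteq> 0" and "m \<bullet> p = 1" "m \<bullet> q = 1" "m \<bullet> x = 1"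
  shows "x \<in> affine hull {p, q}"
proof -
  have "q \<noteq> 0" "p \<noteq> q" using assms by auto
  moreover have "p \<notin> span {q}"
    using assms by (auto simp: span_singleton cross_mult_left)
  ultimately have "independent {p, q}" by (simp add: independent_insert)
  then have "P \<subseteq> span {p, q}"
    using P \<open>p \<noteq> q\<close> by (intro card_ge_dim_independent) auto
  then have "x \<in> span {p, q}" using P by blast
  then obtain a b where x: "x = a *\<^sub>R p + b *\<^sub>R q"
    by (auto simp: span_insert span_singleton algebra_simps)
  then have "a + b = 1" using assms by (simp add: inner_add_right)
  then show ?thesis using x by (auto simp: affine_hull_2)
qed

theorem theorem6:
  fixes G :: geometry and A B C D :: "real^3" and w :: "(real^3) set"
  assumes "G = S2 \<or> G = H2"
    and "A \<in> surface G" "B \<in> surface G" "C \<in> surface G" "D \<in> surface G"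
    and "distinct [A, B, C, D]"
    and "geo_collinear G {A, B, C, D}"
    and "\<forall>P \<in> {A, B, C, D}. \<forall>Q \<in> {A, B, C, D}. \<not> antipodal G P Q"
    and "affine w" "aff_dim w = 2" "0 \<notin> w"
    and "has_central_proj w A" "has_central_proj w B"
        "has_central_proj w C" "has_central_proj w D"
  shows "cross_ratio G A B C D =
         cross_ratio (E2 w) (central_proj w A) (central_proj w B) (central_proj w C) (central_proj w D)"
proof -
  define N where "N = cross3 A B"
  \<comment> \<open>distinct points that are not antipodal are linearly independent\<close>
  have "N \<noteq> 0" using antipodal_if_parallel[of G A B] assms unfolding N_def by auto
  then have NAB: "N \<bullet> cross3 A B \<noteq> 0" by (simp add: N_def)
  obtain P where P: "subspace P" "dim P = 2" "{A, B, C, D} \<subseteq> surface G \<inter> P"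
    using assms(1,7) curved_geo_line_plane unfolding geo_collinear_def by metis
  obtain \<gamma> where \<gamma>: "oriented_line G \<gamma>" "range \<gamma> = surface G \<inter> P"
    using oriented_line_exists[of G P A B] assms(1) P \<open>N \<noteq> 0\<close> N_def by auto
  have curved: "cross_ratio G A B C D = area_cross_ratio N A B C D"
    using \<gamma> P NAB by (intro cross_ratio_eq_area_cross_ratio) auto

  obtain m where m: "w = {x. m \<bullet> x = 1}" using plane_normal_form assms(9-11) by blast
  define \<rho> where "\<rho> X = 1 / (m \<bullet> X)" for X
  have proj: "central_proj w X = \<rho> X *\<^sub>R X" "\<rho> X \<noteq> 0" "m \<bullet> central_proj w X = 1"
      "central_proj w X \<in> P" if "X \<in> {A, B, C, D}" for X
  proof -
    have "has_central_proj w X" using that assms by auto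
    note * = central_proj_eq[OF m this]
    then show "central_proj w X = \<rho> X *\<^sub>R X" "\<rho> X \<noteq> 0" "m \<bullet> central_proj w X = 1"
      by (auto simp: \<rho>_def)
    show "central_proj w X \<in> P" using * that P by (auto intro!: subspace_scale)
  qed
  let ?p = "central_proj w"
  have cr: "cross3 (?p A) (?p B) = (\<rho> A * \<rho> B) *\<^sub>R N"
    by (simp add: proj N_def cross_mult_left cross_mult_right)
  then have nz: "cross3 (?p A) (?p B) \<noteq> 0" using proj(2) \<open>N \<noteq> 0\<close> by simp
  then have "?p A \<noteq> ?p B" by auto
  then obtain \<delta> where \<delta>: "oriented_line (E2 w) \<delta>" "range \<delta> = affine hull {?p A, ?p B}"
    using euclidean_oriented_line_exists[OF assms(9)] proj(3) m by blast
  have "?p X \<in> range \<delta>" if "X \<in> {A, B, C, D}" for X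
    unfolding \<delta>(2) using that proj nz by (intro plane_section_affine_hull[OF P(1,2)]) auto
  then have "cross_ratio (E2 w) (?p A) (?p B) (?p C) (?p D)
      = area_cross_ratio N (?p A) (?p B) (?p C) (?p D)"
    using \<delta>(1) cr proj(2) \<open>N \<noteq> 0\<close> by (intro cross_ratio_eq_area_cross_ratio) auto
  also have "\<dots> = area_cross_ratio N A B C D"
    by (simp add: proj area_cross_ratio_scale)
  finally show ?thesis using curved by simp
qed

end
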